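(* Let $f$ and $g$ be possibly nonconvex, and let $\{x_k\}$ be generated by the niAPG algorithm with inexact proximal steps, where at every iteration $k\ge1$ the point $x_{k+1}$ satisfies $$F(x_{k+1})\le F(v_k)-\frac{\delta}{2}\|x_{k+1}-v_k\|_2^2 .$$ Then $\{x_k\}$ has at least one limit point.
   Context: Setting: $F=f+g$ on $\mathbb{R}^d$, where $f:\mathbb{R}^d\to\mathbb{R}$ is differentiable and $L$-Lipschitz smooth ($\|\nabla f(x)-\nabla f(y)\|_2\le L\|x-y\|_2$ for all $x,y$), $g:\mathbb{R}^d\to(-\infty,+\infty]$ is proper and lower semicontinuous, $F$ is bounded from below, and $F(x)\to\infty$ as $\|x\|_2\to\infty$. The exact proximal step is $\mathrm{prox}_{\eta g}(z)=\arg\min_x \frac12\|x-z\|_2^2+\eta g(x)$. niAPG algorithm: choose $\eta\in(0,1/L)$, $\delta\in(0,\frac1\eta-L)$, and an integer $q\ge 0$; put $\rho=1/\eta$ and $x_0=x_1=0$. For $k=1,2,\dots$: $y_k=x_k+\frac{k-1}{k+2}(x_k-x_{k-1})$; $\Delta_k=\max_{t=\max(1,k-q),\dots,k}F(x_t)$; $v_k=y_k$ if $F(y_k)\le\Delta_k$, and $v_k=x_k$ otherwise; $z_k=v_k-\eta\nabla f(v_k)$; $x_{k+1}$ is an inexact version of $\mathrm{prox}_{\eta g}(z_k)$, the inexactness being controlled only by the inequality stated in the claim.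
   Formalization: It is additionally assumed that each x_{k+1}, k ≥ 1, has finite g-value; this is automatic if g(0) < ∞, but if g(0) = +∞ the inequality may read ∞ ≤ ∞ at every step and the claim can fail. *)

theory Defs
  imports "HOL-Analysis.Analysis"
begin

definition proper :: "('a \<Rightarrow> ereal) \<Rightarrow> bool" where
  "proper g \<longleftrightarrow> (\<forall>x. g x \<noteq> -\<infinity>) \<and> (\<exists>x. g x \<noteq> \<infinity>)"

definition lower_semicontinuous :: "('a::topological_space \<Rightarrow> ereal) \<Rightarrow> bool" where
  "lower_semicontinuous g \<longleftrightarrow> (\<forall>x. g x \<le> Liminf (at x) g)"

definition objective :: "('a \<Rightarrow> real) \<Rightarrow> ('a \<Rightarrow> ereal) \<Rightarrow> 'a \<Rightarrow> ereal" where
  "objective f g x = ereal (f x) + g x"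

definition prox_objective :: "real \<Rightarrow> ('a::real_normed_vector \<Rightarrow> ereal) \<Rightarrow> 'a \<Rightarrow> 'a \<Rightarrow> ereal" where
  "prox_objective \<eta> g z x = ereal (1/2 * (norm (x - z))\<^sup>2) + ereal \<eta> * g x"

text \<open>The minimizer need not exist or be unique for nonconvex \<open>g\<close>, so the proximal map is
  set-valued.\<close>

definition prox :: "real \<Rightarrow> ('a::real_normed_vector \<Rightarrow> ereal) \<Rightarrow> 'a \<Rightarrow> 'a set" where
  "prox \<eta> g z = {x. is_arg_min (prox_objective \<eta> g z) (\<lambda>_. True) x}"

text \<open>An approximate solution of the proximal problem is at least a feasible one: its objective
  value is finite. Every exact solution has this property. For niAPG it is automatic if
  \<open>0\<close> lies in the domain of \<open>g\<close>, since the descent inequality then keeps all objective values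
  finite; if \<open>g 0 = \<infinity>\<close>, the inequality reads \<open>F (x (k + 1)) \<le> \<infinity>\<close> in the first step and by
  itself allows infeasible iterates that run off to infinity.\<close>

definition prox_feasible :: "real \<Rightarrow> ('a::real_normed_vector \<Rightarrow> ereal) \<Rightarrow> 'a \<Rightarrow> 'a \<Rightarrow> bool" where
  "prox_feasible \<eta> g z x \<longleftrightarrow> prox_objective \<eta> g z x < \<infinity>"

lemma prox_feasible_if_prox:
  assumes "proper g" "\<eta> > 0" "p \<in> prox \<eta> g z"
  shows "prox_feasible \<eta> g z p"
proof -
  obtain x where x: "g x \<noteq> \<infinity>" "g x \<noteq> -\<infinity>"
    using assms(1) by (auto simp: proper_def)
  then obtain r where "g x = ereal r" by (cases "g x") auto
  then have "prox_objective \<eta> g z x < \<infinity>"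
    by (simp add: prox_objective_def)
  moreover have "prox_objective \<eta> g z p \<le> prox_objective \<eta> g z x"
    using assms(3) by (auto simp: prox_def is_arg_min_def not_less)
  ultimately show ?thesis
    unfolding prox_feasible_def by (rule order.strict_trans1[rotated])
qed

text \<open>Truncated subtraction is harmless in the index set: \<open>k - q\<close> is only used inside
  \<open>max 1\<close>.\<close>

definition window_max :: "('a \<Rightarrow> ereal) \<Rightarrow> nat \<Rightarrow> (nat \<Rightarrow> 'a) \<Rightarrow> nat \<Rightarrow> ereal" where
  "window_max F q x k = Max ((\<lambda>t. F (x t)) ` {max 1 (k - q)..k})"

text \<open>All steps of niAPG except the choice of \<open>x (Suc k)\<close>; \<open>f'\<close> is the gradient of \<open>f\<close>.\<close>

definition niAPG_steps ::
  "('a::real_inner \<Rightarrow> real) \<Rightarrow> ('a \<Rightarrow> 'a) \<Rightarrow> ('a \<Rightarrow> ereal) \<Rightarrow> real \<Rightarrow> nat \<Rightarrow>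
    (nat \<Rightarrow> 'a) \<Rightarrow> (nat \<Rightarrow> 'a) \<Rightarrow> (nat \<Rightarrow> 'a) \<Rightarrow> (nat \<Rightarrow> 'a) \<Rightarrow> bool" where
  "niAPG_steps f f' g \<eta> q x y v z \<longleftrightarrow>
     x 0 = 0 \<and> x 1 = 0 \<and>
     (\<forall>k\<ge>1.
        y k = x k + ((real k - 1) / (real k + 2)) *\<^sub>R (x k - x (k - 1)) \<and>
        v k = (if objective f g (y k) \<le> window_max (objective f g) q x k then y k else x k) \<and>
        z k = v k - \<eta> *\<^sub>R f' (v k))"

end

theory Submission
  imports Defs
begin

text \<open>The extrapolated point is accepted only if its value is at most the maximum over the window,
  so the descent inequality bounds every new value by that maximum, and the values never leave the
  range of the first full window; coercivity and Bolzano--Weierstrass give the limit point. The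
  only trap is \<open>g 0 = \<infinity>\<close>: the values are finite only from index 2 on, so the bound is
  started from the window \<open>{2..q + 2}\<close>, after which index 1 no longer occurs.\<close>

lemma window_max_le:
  assumes "k \<ge> 1" and "\<And>t. max 1 (k - q) \<le> t \<Longrightarrow> t \<le> k \<Longrightarrow> F (x t) \<le> C"
  shows "window_max F q x k \<le> C"
  unfolding window_max_def using assms by (intro Max.boundedI) auto

lemma le_window_max:
  assumes "k \<ge> 1"
  shows "F (x k) \<le> window_max F q x k"
  unfolding window_max_def using assms by (intro Max_ge) auto

text \<open>An accepted \<open>y k\<close> passes the test by construction; the fallback
  \<open>x k\<close> is the last point of the window.\<close>

lemma niAPG_le_window_max:
  assumes "niAPG_steps f f' g \<eta> q x y v z" "k \<ge> 1"
  shows "objective f g (v k) \<le> window_max (objective f g) q x k"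
proof -
  have "v k = (if objective f g (y k) \<le> window_max (objective f g) q x k then y k else x k)"
    using assms unfolding niAPG_steps_def by blast
  then show ?thesis
    using le_window_max[OF assms(2), of "objective f g" x q] by simp
qed

text \<open>Since \<eta> is positive, an infinite \<open>g x\<close> would make the proximal
  objective infinite as well.\<close>

lemma objective_less_top_if_prox_feasible:
  assumes "\<eta> > 0" "prox_feasible \<eta> g z x"
  shows "objective f g x < \<infinity>"
proof -
  have "g x \<noteq> \<infinity>"
    using assms by (auto simp: prox_feasible_def prox_objective_def)
  then show ?thesis
    by (cases "g x") (auto simp: objective_def)
qed

lemma bounded_sublevel_if_coercive:
  fixes F :: "'a::real_normed_vector \<Rightarrow> ereal"
  assumes "(F \<longlongrightarrow> \<infinity>) at_infinity" "C < \<infinity>"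
  shows "bounded {u. F u \<le> C}"
proof -
  have "eventually (\<lambda>u. C < F u) at_infinity"
    using assms by (rule order_tendstoD)
  then obtain B where "\<And>u. B \<le> norm u \<Longrightarrow> C < F u"
    unfolding eventually_at_infinity by blast
  then have "norm u \<le> B" if "F u \<le> C" for u
    using that by (meson leD le_cases)
  then show ?thesis
    by (auto simp: bounded_iff)
qed

theorem theorem4p7:
  fixes f :: "real ^ 'd \<Rightarrow> real" and f' :: "real ^ 'd \<Rightarrow> real ^ 'd"
    and g :: "real ^ 'd \<Rightarrow> ereal"
    and L \<eta> \<delta> :: real and q :: nat
    and x y v z :: "nat \<Rightarrow> real ^ 'd"
  assumes L_pos: "L > 0"
    and gradient: "\<And>u. GDERIV f u :> f' u"
    and smooth: "\<And>u w. norm (f' u - f' w) \<le> L * norm (u - w)"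
    and proper: "proper g"
    and lsc: "lower_semicontinuous g"
    and bounded_below: "\<exists>b::real. \<forall>u. ereal b \<le> objective f g u"
    and coercive: "(objective f g \<longlongrightarrow> \<infinity>) at_infinity"
    and eta: "0 < \<eta>" "\<eta> < 1 / L"
    and delta: "0 < \<delta>" "\<delta> < 1 / \<eta> - L"
    and steps: "niAPG_steps f f' g \<eta> q x y v z"
    and inexact_prox: "\<And>k. k \<ge> 1 \<Longrightarrow> prox_feasible \<eta> g (z k) (x (Suc k))"
    and descent: "\<And>k. k \<ge> 1 \<Longrightarrow>
      objective f g (x (Suc k)) \<le> objective f g (v k) - ereal (\<delta> / 2 * (norm (x (Suc k) - v k))\<^sup>2)"
  shows "\<exists>l r. strict_mono r \<and> (x \<circ> r) \<longlonglongrightarrow> l"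
proof -
  let ?F = "objective f g"
  define C where "C = Max ((\<lambda>t. ?F (x t)) ` {2..q + 2})"
  have finite_value: "?F (x t) < \<infinity>" if t: "t \<ge> 2" for t
  proof -
    obtain k where "t = Suc k" "k \<ge> 1"
      using t by (cases t) auto
    then show ?thesis
      using objective_less_top_if_prox_feasible[OF eta(1) inexact_prox] by simp
  qed
  have C: "C < \<infinity>"
    unfolding C_def using finite_value by (subst Max_less_iff) auto
  have le_C: "?F (x k) \<le> C" if "k \<ge> 2" for k
    using that
  \<comment> \<open>Strong induction, because the window reaches back \<open>q\<close>
    steps.\<close>
  proof (induction k rule: less_induct)
    case (less k)
    show ?case
    proof (cases "k \<le> q + 2")
      case True
      then show ?thesis
        unfolding C_def using less.prems by (intro Max_ge) auto
    next
      case False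
      then obtain m where m: "k = Suc m" "m \<ge> q + 2"
        by (cases k) auto
      have "?F (x k) \<le> ?F (v m) - ereal (\<delta> / 2 * (norm (x k - v m))\<^sup>2)"
        using descent[of m] m by simp
      \<comment> \<open>The subtracted term is a nonnegative real, so dropping it is sound for
        infinite values too.\<close>
      also have "\<dots> \<le> ?F (v m)"
        using delta(1) by (cases "?F (v m)") auto
      also have "\<dots> \<le> window_max ?F q x m"
        using niAPG_le_window_max[OF steps] m by simp
      \<comment> \<open>From \<open>m \<ge> q + 2\<close> the window starts at
        \<open>m - q \<ge> 2\<close> and ends at \<open>m < k\<close>, so the induction hypothesis
        covers all of it.\<close>
      also have "\<dots> \<le> C"
        using m less.IH by (intro window_max_le) auto
      finally show ?thesis .
    qed
  qed
  \<comment> \<open>The shift drops the indices 0 and 1, where the value may exceed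
    \<open>C\<close>.\<close>
  have "bounded (range (\<lambda>n. x (n + 2)))"
    by (rule bounded_subset[OF bounded_sublevel_if_coercive[OF coercive C]]) (auto intro: le_C)
  then obtain l r where r: "strict_mono r" "((\<lambda>n. x (n + 2)) \<circ> r) \<longlonglongrightarrow> l"
    using bounded_imp_convergent_subsequence by blast
  \<comment> \<open>The shift moves into the index map, giving a subsequence of \<open>x\<close>
    itself.\<close>
  have "strict_mono (\<lambda>n. r n + 2)" "(x \<circ> (\<lambda>n. r n + 2)) \<longlonglongrightarrow> l"
    using r by (simp_all add: strict_mono_def comp_def)
  then show ?thesis
    by blast
qed

end
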